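(* Let $m\ge1$, $n\ge0$ be integers and $\Omega\subset\mathbb R^{2m}$ open. A superfunction $F\in C^\infty(\Omega)\otimes\mathfrak G_{2n}$ is holomorphic in the variables $z_1,\dots,z_m,\grave z_1,\dots,\grave z_n$ if and only if the spinor-valued function $F\,I_bI_f$ is sh-monogenic, i.e. $\partial_{\mathbf Z}[F I_bI_f]=0=\partial_{\mathbf Z^\dagger}[F I_bI_f]$.
   Context: Superspace. Commuting variables $x_1,\dots,x_{2m}$ (coordinates of $\underline x\in\mathbb R^{2m}$), anticommuting variables $\grave x_1,\dots,\grave x_{2n}$ commuting with the $x_j$; $\mathfrak G_{2n}$ is the Grassmann algebra generated by the $\grave x_j$. Elements of $C^\infty(\Omega)\otimes\mathfrak G_{2n}$ are $F=\sum_A F_A(\underline x)\grave{\underline x}_A$ with $F_A$ complex-valued smooth and $\grave{\underline x}_A$ ordered monomials. $\partial_{\grave x_j}$ is the left derivative ($\partial_{\grave x_j}[1]=0$, $\partial_{\grave x_j}\grave x_k+\grave x_k\partial_{\grave x_j}=\delta_{jk}$, commuting with the $x_k$). Complex variables: $z_j=x_j+ix_{m+j}$, $\grave z_j=\grave x_{2j-1}+i\grave x_{2j}$; $\partial_{z_j}=\frac12(\partial_{x_j}-i\partial_{x_{m+j}})$, $\partial_{z_j^c}=\frac12(\partial_{x_j}+i\partial_{x_{m+j}})$ ($1\le j\le m$), $\partial_{\grave z_j}=\frac12(\partial_{\grave x_{2j-1}}-i\partial_{\grave x_{2j}})$, $\partial_{\grave z_j^c}=\frac12(\partial_{\grave x_{2j-1}}+i\partial_{\grave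 x_{2j}})$ ($1\le j\le n$). $F$ is holomorphic in $z_1,\dots,z_m,\grave z_1,\dots,\grave z_n$ if $\partial_{z_j^c}[F]=0=\partial_{\grave z_k^c}[F]$ for all $1\le j\le m$, $1\le k\le n$. Clifford generators. $\mathcal C_{2m,2n}$ is generated by $e_1,\dots,e_{2m},\grave e_1,\dots,\grave e_{2n}$ with $e_je_k+e_ke_j=-2\delta_{jk}$, $e_j\grave e_k+\grave e_ke_j=0$, $\grave e_j\grave e_k-\grave e_k\grave e_j=g_{jk}$, where $g_{2j,2k}=g_{2j-1,2k-1}=0$, $g_{2j-1,2k}=-g_{2k,2j-1}=\delta_{jk}$; it commutes with all variables $x_j,\grave x_j$ and their partial derivatives. Complex scalars are allowed. Put $\mathfrak f_j=\frac12(e_j-ie_{m+j})$, $\mathfrak f_j^\dagger=-\frac12(e_j+ie_{m+j})$ ($1\le j\le m$), $\grave{\mathfrak f}_j=\frac12(\grave e_{2j-1}-i\grave e_{2j})$, $\grave{\mathfrak f}_j^\dagger=-\frac12(\grave e_{2j-1}+i\grave e_{2j})$ ($1\le j\le n$). Hermitian Dirac operators: $\partial_{\mathbf Z}=\sum_{j=1}^m\mathfrak f_j^\dagger\partial_{z_j}+2i\sum_{j=1}^n\grave{\mathfrak f}_j^\dagger\partial_{\grave z_j}$, $\partial_{\mathbf Z^\dagger}=\sum_{j=1}^m\mathfrak f_j\partial_{z_j^c}-2i\sum_{j=1}^n\grave{\mathfrak f}_j\partial_{\grave z_j^c}$. Spinors. $I_b=\mathfrak f_1^\dagger\mathfrak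 f_1\cdots\mathfrak f_m^\dagger\mathfrak f_m$. The symplectic generators act on smooth functions of auxiliary commuting real variables $a_1,\dots,a_n$ through the identifications $\grave e_{2j-1}\to e_{2m+1}\partial_{a_j}$, $\grave e_{2j}\to-e_{2m+1}a_j$, where $e_{2m+1}$ is an additional orthogonal Clifford generator ($e_{2m+1}^2=-1$, anticommuting with $e_1,\dots,e_{2m}$); $I_f=\exp\left(\frac i2\sum_{j=1}^na_j^2\right)$. The operators $\partial_{\mathbf Z},\partial_{\mathbf Z^\dagger}$ act on $FI_bI_f$ by letting the partial derivatives act on $F$ and the Clifford elements act on $I_bI_f$ from the left in this realization. *)

theory Defs
  imports "HOL-Analysis.Analysis"
begin

section \<open>Complex scalars\<close>

class complex_normed_vector = real_normed_vector +
  fixes scaleC :: "complex \<Rightarrow> 'a \<Rightarrow> 'a"  (infixr "*\<^sub>C" 75)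
  assumes scaleC_add_right: "c *\<^sub>C (x + y) = c *\<^sub>C x + c *\<^sub>C y"
    and scaleC_add_left: "(c + d) *\<^sub>C x = c *\<^sub>C x + d *\<^sub>C x"
    and scaleC_scaleC: "c *\<^sub>C d *\<^sub>C x = (c * d) *\<^sub>C x"
    and scaleR_scaleC: "r *\<^sub>R x = of_real r *\<^sub>C x"
    and norm_scaleC: "norm (c *\<^sub>C x) = cmod c * norm x"

instantiation complex :: complex_normed_vector
begin

definition scaleC_complex :: "complex \<Rightarrow> complex \<Rightarrow> complex"
  where "scaleC_complex c x = c * x"

instance
  by standard (auto simp: scaleC_complex_def algebra_simps norm_mult scaleR_conv_of_real)

end


section \<open>The orthogonal Clifford algebra\<close>

text \<open>
  The complex Clifford algebra with generators \<open>e\<^sub>0, e\<^sub>1, \<dots>\<close>, modelled by the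
  coefficients with respect to the basis of ordered monomials
  \<open>e\<^sub>A = e\<^bsub>i1\<^esub> \<cdots> e\<^bsub>ik\<^esub>\<close>, \<open>A = {i1 < \<dots> < ik}\<close>.  The subalgebra generated by
  \<open>e\<^sub>0, \<dots>, e\<^bsub>N-1\<^esub>\<close> is the Clifford algebra on \<open>N\<close> generators.
\<close>

typedef clifford =
  "{u :: nat set \<Rightarrow> complex. \<exists>N. \<forall>A. u A \<noteq> 0 \<longrightarrow> A \<subseteq> {..<N}}"
  morphisms coeff Abs_clifford
  by (rule exI[of _ "\<lambda>_. 0"]) simp

setup_lifting type_definition_clifford

text \<open>
  \<open>e\<^sub>A e\<^sub>B = \<plusminus> e\<^sub>C\<close> with \<open>C\<close> the symmetric difference: every pair \<open>j < i\<close> contributes a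
  transposition and every common index a factor \<open>e\<^sub>i\<^sup>2 = - 1\<close>.
\<close>

definition clifford_sign :: "nat set \<Rightarrow> nat set \<Rightarrow> complex"
  where "clifford_sign A B = (- 1) ^ card {(i, j). i \<in> A \<and> j \<in> B \<and> j \<le> i}"

lemma coeff_bound_max:
  assumes "\<exists>N. \<forall>A. u A \<noteq> (0::complex) \<longrightarrow> A \<subseteq> {..<N::nat}"
    and "\<exists>N. \<forall>A. v A \<noteq> (0::complex) \<longrightarrow> A \<subseteq> {..<N::nat}"
  obtains N where "\<And>A. u A \<noteq> 0 \<Longrightarrow> A \<subseteq> {..<N}" "\<And>A. v A \<noteq> 0 \<Longrightarrow> A \<subseteq> {..<N}"
proof -
  from assms obtain M N where M: "\<forall>A. u A \<noteq> 0 \<longrightarrow> A \<subseteq> {..<M}"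
    and N: "\<forall>A. v A \<noteq> 0 \<longrightarrow> A \<subseteq> {..<N}" by blast
  have "A \<subseteq> {..<max M N}" if "u A \<noteq> 0" for A
    using M that by fastforce
  moreover have "A \<subseteq> {..<max M N}" if "v A \<noteq> 0" for A
    using N that by fastforce
  ultimately show thesis using that by blast
qed

instantiation clifford :: "{zero, one, plus, minus, uminus, times, scaleR}"
begin

lift_definition zero_clifford :: clifford is "\<lambda>_. 0"
  by simp

lift_definition one_clifford :: clifford is "\<lambda>A. if A = {} then 1 else 0"
  by simp

lift_definition plus_clifford :: "clifford \<Rightarrow> clifford \<Rightarrow> clifford" is "\<lambda>u v A. u A + v A"
  by (erule (1) coeff_bound_max) (metis add.right_neutral)

lift_definition minus_clifford :: "clifford \<Rightarrow> clifford \<Rightarrow> clifford" is "\<lambda>u v A. u A - v A"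
  by (erule (1) coeff_bound_max) (metis diff_self)

lift_definition uminus_clifford :: "clifford \<Rightarrow> clifford" is "\<lambda>u A. - u A"
  by simp

lift_definition times_clifford :: "clifford \<Rightarrow> clifford \<Rightarrow> clifford" is
  "\<lambda>u v C. \<Sum>A | u A \<noteq> 0. clifford_sign A (sym_diff A C) * u A * v (sym_diff A C)"
proof -
  fix u v :: "nat set \<Rightarrow> complex"
  assume "\<exists>N. \<forall>A. u A \<noteq> 0 \<longrightarrow> A \<subseteq> {..<N}" "\<exists>N. \<forall>A. v A \<noteq> 0 \<longrightarrow> A \<subseteq> {..<N}"
  then obtain N where N: "\<And>A. u A \<noteq> 0 \<Longrightarrow> A \<subseteq> {..<N}" "\<And>A. v A \<noteq> 0 \<Longrightarrow> A \<subseteq> {..<N}"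
    by (rule coeff_bound_max) blast
  have "C \<subseteq> {..<N}"
    if "(\<Sum>A | u A \<noteq> 0. clifford_sign A (sym_diff A C) * u A * v (sym_diff A C)) \<noteq> 0" for C
  proof -
    from sum.not_neutral_contains_not_neutral[OF that] obtain A
      where "u A \<noteq> 0" "v (sym_diff A C) \<noteq> 0" by auto
    with N have "A \<subseteq> {..<N}" "sym_diff A C \<subseteq> {..<N}" by blast+
    then show ?thesis by blast
  qed
  then show "\<exists>N. \<forall>C. (\<Sum>A | u A \<noteq> 0. clifford_sign A (sym_diff A C) * u A * v (sym_diff A C)) \<noteq> 0
      \<longrightarrow> C \<subseteq> {..<N}" by blast
qed

lift_definition scaleR_clifford :: "real \<Rightarrow> clifford \<Rightarrow> clifford" is "\<lambda>r u A. of_real r * u A"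
  by auto

instance ..

end

definition l1norm :: "clifford \<Rightarrow> real"
  where "l1norm u = (\<Sum>A | coeff u A \<noteq> 0. cmod (coeff u A))"

lemma coeff_eqI: "(\<And>A. coeff u A = coeff v A) \<Longrightarrow> u = v"
  by (simp add: coeff_inject[symmetric] ext)

definition in_gens :: "nat \<Rightarrow> clifford \<Rightarrow> bool"
  where "in_gens N u \<longleftrightarrow> (\<forall>A. coeff u A \<noteq> 0 \<longrightarrow> A \<subseteq> {..<N})"

lemma in_gens_mono: "in_gens M u \<Longrightarrow> M \<le> N \<Longrightarrow> in_gens N u"
  unfolding in_gens_def by (meson lessThan_subset_iff order_trans)

lemma in_gens_ex:
  obtains N where "in_gens N u"
  using coeff[of u] unfolding in_gens_def by blast

lemma in_gens_ex3:
  obtains N where "in_gens N u" "in_gens N v" "in_gens N w"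
proof -
  obtain K L M where "in_gens K u" "in_gens L v" "in_gens M w"
    using in_gens_ex by metis
  then have "in_gens (K + L + M) u" "in_gens (K + L + M) v" "in_gens (K + L + M) w"
    by (simp_all add: in_gens_mono)
  then show thesis by (rule that)
qed

lemma finite_coeff: "finite {A. coeff u A \<noteq> 0}"
proof -
  obtain N where "in_gens N u" by (rule in_gens_ex)
  then have "{A. coeff u A \<noteq> 0} \<subseteq> Pow {..<N}" by (auto simp: in_gens_def)
  then show ?thesis by (rule finite_subset) simp
qed

lemma coeff_simps [simp]:
  "coeff 0 A = 0" "coeff 1 A = (if A = {} then 1 else 0)"
  "coeff (u + v) A = coeff u A + coeff v A" "coeff (u - v) A = coeff u A - coeff v A"
  "coeff (- u) A = - coeff u A" "coeff (r *\<^sub>R u) A = of_real r * coeff u A"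
  by (transfer; simp)+

lemma coeff_mult:
  assumes "in_gens N u"
  shows "coeff (u * v) C =
    (\<Sum>A\<in>Pow {..<N}. clifford_sign A (sym_diff A C) * coeff u A * coeff v (sym_diff A C))"
  unfolding times_clifford.rep_eq
  by (rule sum.mono_neutral_left) (use assms in \<open>auto simp: in_gens_def\<close>)

lemma l1norm_coeff:
  assumes "in_gens N u"
  shows "l1norm u = (\<Sum>A\<in>Pow {..<N}. cmod (coeff u A))"
  unfolding l1norm_def
  by (rule sum.mono_neutral_left) (use assms in \<open>auto simp: in_gens_def\<close>)

lemma in_gens_mult:
  assumes "in_gens N u" "in_gens N v"
  shows "in_gens N (u * v)"
  unfolding in_gens_def
proof (intro allI impI)
  fix C assume "coeff (u * v) C \<noteq> 0"
  then have "(\<Sum>A\<in>Pow {..<N}. clifford_sign A (sym_diff A C) * coeff u A * coeff v (sym_diff A C)) \<noteq> 0"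
    using coeff_mult[OF assms(1)] by simp
  from sum.not_neutral_contains_not_neutral[OF this]
  obtain A where A: "A \<subseteq> {..<N}" "coeff v (sym_diff A C) \<noteq> 0" by auto
  with assms(2) have "sym_diff A C \<subseteq> {..<N}" unfolding in_gens_def by blast
  with A(1) show "C \<subseteq> {..<N}" by blast
qed

lemma minus_one_power_card_sym_diff:
  assumes "finite X" "finite Y"
  shows "(- 1 :: complex) ^ card (sym_diff X Y) = (- 1) ^ card X * (- 1) ^ card Y"
proof -
  have "card X = card (X - Y) + card (X \<inter> Y)" "card Y = card (Y - X) + card (X \<inter> Y)"
    by (subst card_Un_disjoint[symmetric], use assms in \<open>auto intro: arg_cong[of _ _ card]\<close>)+
  moreover have "card (sym_diff X Y) = card (X - Y) + card (Y - X)"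
    by (rule card_Un_disjoint) (use assms in auto)
  ultimately show ?thesis
    by (simp add: power_add mult.assoc mult.left_commute flip: power_mult_distrib)
qed

lemma finite_sign_pairs:
  assumes "finite A" "finite B"
  shows "finite {(i :: nat, j). i \<in> A \<and> j \<in> B \<and> j \<le> i}"
  by (rule finite_subset[of _ "A \<times> B"]) (use assms in auto)

lemma clifford_sign_sym_diff:
  assumes "finite A" "finite B" "finite C"
  shows "clifford_sign (sym_diff A B) C = clifford_sign A C * clifford_sign B C"
    and "clifford_sign C (sym_diff A B) = clifford_sign C A * clifford_sign C B"
proof -
  let ?I = "\<lambda>A B. {(i :: nat, j). i \<in> A \<and> j \<in> B \<and> j \<le> i}"
  have "?I (sym_diff A B) C = sym_diff (?I A C) (?I B C)"
    "?I C (sym_diff A B) = sym_diff (?I C A) (?I C B)" by blast+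
  then show "clifford_sign (sym_diff A B) C = clifford_sign A C * clifford_sign B C"
    "clifford_sign C (sym_diff A B) = clifford_sign C A * clifford_sign C B"
    unfolding clifford_sign_def
    by (simp_all only: minus_one_power_card_sym_diff finite_sign_pairs assms)
qed

lemma sum_Pow_sym_diff:
  assumes "A \<subseteq> U"
  shows "(\<Sum>C\<in>Pow U. f C) = (\<Sum>B\<in>Pow U. f (sym_diff A B))"
proof (rule sum.reindex_bij_witness[of _ "sym_diff A" "sym_diff A"])
  fix C assume C: "C \<in> Pow U"
  show *: "sym_diff A (sym_diff A C) = C" by blast
  show "sym_diff A C \<in> Pow U" using assms C by blast
  show "f (sym_diff A (sym_diff A C)) = f C" by (simp only: *)
qed (use assms in blast)+

lemma clifford_mult_assoc: "(u * v) * w = u * (v * (w :: clifford))"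
proof (rule coeff_eqI)
  fix D
  obtain N where N: "in_gens N u" "in_gens N v" "in_gens N w"
    by (rule in_gens_ex3)
  let ?P = "Pow {..<N}" and ?s = clifford_sign
  have "coeff ((u * v) * w) D = (\<Sum>C\<in>?P. \<Sum>A\<in>?P. ?s C (sym_diff C D) *
      (?s A (sym_diff A C) * coeff u A * coeff v (sym_diff A C)) * coeff w (sym_diff C D))"
    by (simp add: coeff_mult[OF in_gens_mult[OF N(1,2)]] coeff_mult[OF N(1)]
        sum_distrib_left sum_distrib_right)
  also have "\<dots> = (\<Sum>A\<in>?P. \<Sum>C\<in>?P. ?s C (sym_diff C D) *
      (?s A (sym_diff A C) * coeff u A * coeff v (sym_diff A C)) * coeff w (sym_diff C D))"
    by (rule sum.swap)
  also have "\<dots> = (\<Sum>A\<in>?P. \<Sum>B\<in>?P. ?s A (sym_diff A D) * coeff u A *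
      (?s B (sym_diff B (sym_diff A D)) * coeff v B * coeff w (sym_diff B (sym_diff A D))))"
  proof (rule sum.cong[OF refl])
    fix A assume A: "A \<in> ?P"
    have "(\<Sum>C\<in>?P. ?s C (sym_diff C D) *
        (?s A (sym_diff A C) * coeff u A * coeff v (sym_diff A C)) * coeff w (sym_diff C D)) =
      (\<Sum>B\<in>?P. ?s (sym_diff A B) (sym_diff (sym_diff A B) D) *
        (?s A (sym_diff A (sym_diff A B)) * coeff u A * coeff v (sym_diff A (sym_diff A B))) *
        coeff w (sym_diff (sym_diff A B) D))"
      by (rule sum_Pow_sym_diff) (use A in auto)
    also have "\<dots> = (\<Sum>B\<in>?P. ?s A (sym_diff A D) * coeff u A *
      (?s B (sym_diff B (sym_diff A D)) * coeff v B * coeff w (sym_diff B (sym_diff A D))))"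
    proof (rule sum.cong[OF refl])
      fix B assume B: "B \<in> ?P"
      define E where "E = sym_diff B (sym_diff A D)"
      have E: "sym_diff (sym_diff A B) D = E" "sym_diff A D = sym_diff B E"
        "sym_diff A (sym_diff A B) = B" by (auto simp: E_def)
      have "?s (sym_diff A B) E * (?s A B * coeff u A * coeff v B) * coeff w E =
          ?s A (sym_diff B E) * coeff u A * (?s B E * coeff v B * coeff w E)"
      proof (cases "coeff w E = 0")
        case False
        with N(3) have "finite E" unfolding in_gens_def by (meson finite_lessThan finite_subset)
        moreover have "finite A" "finite B" using A B finite_subset by auto
        ultimately show ?thesis by (simp add: clifford_sign_sym_diff)
      qed simp
      then show "?s (sym_diff A B) (sym_diff (sym_diff A B) D) *
        (?s A (sym_diff A (sym_diff A B)) * coeff u A * coeff v (sym_diff A (sym_diff A B))) *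
        coeff w (sym_diff (sym_diff A B) D) = ?s A (sym_diff A D) * coeff u A *
      (?s B (sym_diff B (sym_diff A D)) * coeff v B * coeff w (sym_diff B (sym_diff A D)))"
        by (simp only: E(1,3) E_def[symmetric] flip: E(2))
    qed
    finally show "(\<Sum>C\<in>?P. ?s C (sym_diff C D) *
        (?s A (sym_diff A C) * coeff u A * coeff v (sym_diff A C)) * coeff w (sym_diff C D)) =
      (\<Sum>B\<in>?P. ?s A (sym_diff A D) * coeff u A *
      (?s B (sym_diff B (sym_diff A D)) * coeff v B * coeff w (sym_diff B (sym_diff A D))))" .
  qed
  also have "\<dots> = coeff (u * (v * w)) D"
    by (simp add: coeff_mult[OF N(1)] coeff_mult[OF N(2)] sum_distrib_left)
  finally show "coeff ((u * v) * w) D = coeff (u * (v * w)) D" .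
qed

lemma l1norm_mult: "l1norm (u * v) \<le> l1norm u * l1norm v"
proof -
  obtain N where N: "in_gens N u" "in_gens N v"
    by (rule in_gens_ex3[of u v v])
  let ?P = "Pow {..<N}"
  have sgn: "cmod (clifford_sign A B) = 1" for A B
    by (simp add: clifford_sign_def norm_power)
  have "l1norm (u * v) = (\<Sum>C\<in>?P. cmod (coeff (u * v) C))"
    by (rule l1norm_coeff) (rule in_gens_mult[OF N])
  also have "\<dots> \<le> (\<Sum>C\<in>?P. \<Sum>A\<in>?P. cmod (coeff u A) * cmod (coeff v (sym_diff A C)))"
    unfolding coeff_mult[OF N(1)]
    by (intro sum_mono order_trans[OF norm_sum]) (simp add: norm_mult sgn)
  also have "\<dots> = (\<Sum>A\<in>?P. \<Sum>C\<in>?P. cmod (coeff u A) * cmod (coeff v (sym_diff A C)))"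
    by (rule sum.swap)
  also have "\<dots> = (\<Sum>A\<in>?P. cmod (coeff u A) * l1norm v)"
  proof (rule sum.cong[OF refl])
    fix A assume "A \<in> ?P"
    then have "l1norm v = (\<Sum>C\<in>?P. cmod (coeff v (sym_diff A C)))"
      unfolding l1norm_coeff[OF N(2)]
      by (intro sum_Pow_sym_diff[of A _ "\<lambda>B. cmod (coeff v B)"]) simp
    then show "(\<Sum>C\<in>?P. cmod (coeff u A) * cmod (coeff v (sym_diff A C))) = cmod (coeff u A) * l1norm v"
      by (simp add: sum_distrib_left)
  qed
  also have "\<dots> = l1norm u * l1norm v"
    by (simp add: l1norm_coeff[OF N(1)] sum_distrib_right)
  finally show ?thesis .
qed

instantiation clifford :: real_normed_algebra_1
begin

definition norm_clifford :: "clifford \<Rightarrow> real"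
  where "norm_clifford = l1norm"

definition sgn_clifford :: "clifford \<Rightarrow> clifford"
  where "sgn_clifford u = u /\<^sub>R norm u"

definition dist_clifford :: "clifford \<Rightarrow> clifford \<Rightarrow> real"
  where "dist_clifford u v = norm (u - v)"

definition uniformity_clifford :: "(clifford \<times> clifford) filter"
  where "uniformity_clifford = (INF e\<in>{0 <..}. principal {(u, v). dist u v < e})"

definition open_clifford :: "clifford set \<Rightarrow> bool"
  where "open_clifford U \<longleftrightarrow> (\<forall>u\<in>U. eventually (\<lambda>(u', v). u' = u \<longrightarrow> v \<in> U) uniformity)"

instance
proof
  fix u v w :: clifford and r s :: real and U :: "clifford set"
  show "u + v + w = u + (v + w)" "u + v = v + u" "0 + u = u" "- u + u = 0" "u - v = u + - v"
    "r *\<^sub>R (u + v) = r *\<^sub>R u + r *\<^sub>R v" "(r + s) *\<^sub>R u = r *\<^sub>R u + s *\<^sub>R u"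
    "r *\<^sub>R s *\<^sub>R u = (r * s) *\<^sub>R u" "1 *\<^sub>R u = u"
    by (rule coeff_eqI; simp add: algebra_simps)+
  show "u * v * w = u * (v * w)" by (rule clifford_mult_assoc)
  obtain N where N: "in_gens N u" "in_gens N v"
    by (rule in_gens_ex3[of u v w])
  have Nu: "in_gens N (u + v)"
    using N unfolding in_gens_def by (metis add.right_neutral coeff_simps(3))
  have N1: "in_gens 0 1" by (simp add: in_gens_def)
  have Nr: "in_gens N (r *\<^sub>R u)" using N by (simp add: in_gens_def)
  show "1 * u = u"
    by (rule coeff_eqI) (simp add: coeff_mult[OF N1] clifford_sign_def)
  show "u * 1 = u"
  proof (rule coeff_eqI)
    fix C
    have *: "coeff (1 :: clifford) (sym_diff A C) = (if A = C then 1 else 0)" for A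
      by auto
    show "coeff (u * 1) C = coeff u C"
      unfolding coeff_mult[OF N(1)] * if_distrib[of "\<lambda>x. _ * x"]
      using N(1) by (auto simp: sum.delta clifford_sign_def in_gens_def cong: if_cong)
  qed
  show "(u + v) * w = u * w + v * w"
    by (rule coeff_eqI) (simp add: coeff_mult[OF Nu] coeff_mult[OF N(1)] coeff_mult[OF N(2)]
        algebra_simps sum.distrib)
  show "u * (v + w) = u * v + u * w"
    by (rule coeff_eqI) (simp add: coeff_mult[OF N(1)] algebra_simps sum.distrib)
  show "r *\<^sub>R u * v = r *\<^sub>R (u * v)"
    by (rule coeff_eqI) (simp add: coeff_mult[OF N(1)] coeff_mult[OF Nr] sum_distrib_left algebra_simps)
  show "u * r *\<^sub>R v = r *\<^sub>R (u * v)"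
    by (rule coeff_eqI) (simp add: coeff_mult[OF N(1)] sum_distrib_left algebra_simps)
  show "(0 :: clifford) \<noteq> 1"
    by (metis coeff_simps(1,2) zero_neq_one)
  show "dist u v = norm (u - v)" by (rule dist_clifford_def)
  show "sgn u = u /\<^sub>R norm u" by (rule sgn_clifford_def)
  show "uniformity = (INF e\<in>{0 <..}. principal {(u :: clifford, v). dist u v < e})"
    by (rule uniformity_clifford_def)
  show "open U = (\<forall>u\<in>U. \<forall>\<^sub>F (u', v) in uniformity. u' = u \<longrightarrow> v \<in> U)"
    by (rule open_clifford_def)
  show "(norm u = 0) = (u = 0)"
  proof
    assume "norm u = 0"
    then have "\<forall>A\<in>{A. coeff u A \<noteq> 0}. cmod (coeff u A) = 0"
      unfolding norm_clifford_def l1norm_def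
      by (subst (asm) sum_nonneg_eq_0_iff) (auto simp: finite_coeff)
    then show "u = 0" by (intro coeff_eqI) auto
  qed (simp add: norm_clifford_def l1norm_def)
  show "norm (u + v) \<le> norm u + norm v"
    unfolding norm_clifford_def l1norm_coeff[OF N(1)] l1norm_coeff[OF N(2)] l1norm_coeff[OF Nu]
    by (simp add: sum_mono norm_triangle_ineq flip: sum.distrib)
  show "norm (r *\<^sub>R u) = \<bar>r\<bar> * norm u"
    unfolding norm_clifford_def l1norm_coeff[OF N(1)] l1norm_coeff[OF Nr]
    by (simp add: norm_mult flip: sum_distrib_left)
  show "norm (u * v) \<le> norm u * norm v"
    unfolding norm_clifford_def by (rule l1norm_mult)
  show "norm (1 :: clifford) = 1"
    by (simp add: norm_clifford_def l1norm_coeff[OF N1])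
qed

end

instantiation clifford :: complex_normed_vector
begin

lift_definition scaleC_clifford :: "complex \<Rightarrow> clifford \<Rightarrow> clifford" is "\<lambda>c u A. c * u A"
  by auto

instance
proof
  fix c d :: complex and r :: real and u v :: clifford
  show "c *\<^sub>C (u + v) = c *\<^sub>C u + c *\<^sub>C v" "(c + d) *\<^sub>C u = c *\<^sub>C u + d *\<^sub>C u"
    "c *\<^sub>C d *\<^sub>C u = (c * d) *\<^sub>C u" "r *\<^sub>R u = of_real r *\<^sub>C u"
    by (rule coeff_eqI; simp add: scaleC_clifford.rep_eq algebra_simps)+
  obtain N where N: "in_gens N u" by (rule in_gens_ex)
  then have Nc: "in_gens N (c *\<^sub>C u)" by (simp add: in_gens_def scaleC_clifford.rep_eq)
  show "norm (c *\<^sub>C u) = cmod c * norm u"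
    unfolding norm_clifford_def l1norm_coeff[OF N] l1norm_coeff[OF Nc]
    by (simp add: norm_mult scaleC_clifford.rep_eq flip: sum_distrib_left)
qed

end

lemma clifford_mult_scaleC:
  "(c *\<^sub>C u) * v = c *\<^sub>C (u * v)" "u * (c *\<^sub>C v) = c *\<^sub>C (u * (v :: clifford))"
proof -
  obtain N where N: "in_gens N u" by (rule in_gens_ex)
  then have Nc: "in_gens N (c *\<^sub>C u)" by (simp add: in_gens_def scaleC_clifford.rep_eq)
  show "(c *\<^sub>C u) * v = c *\<^sub>C (u * v)"
    by (rule coeff_eqI) (simp add: coeff_mult[OF N] coeff_mult[OF Nc]
        scaleC_clifford.rep_eq sum_distrib_left algebra_simps)
  show "u * (c *\<^sub>C v) = c *\<^sub>C (u * v)"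
    by (rule coeff_eqI) (simp add: coeff_mult[OF N] scaleC_clifford.rep_eq
        sum_distrib_left algebra_simps)
qed

lift_definition e_gen :: "nat \<Rightarrow> clifford" is "\<lambda>k A. if A = {k} then 1 else 0"
  by (metis empty_subsetI insert_subset lessI lessThan_iff)

lemma coeff_e_gen: "coeff (e_gen j) A = (if A = {j} then 1 else 0)"
  by (rule e_gen.rep_eq[THEN fun_cong])

lemma coeff_e_gen_mult:
  "coeff (e_gen j * u) C = clifford_sign {j} (sym_diff {j} C) * coeff u (sym_diff {j} C)"
proof -
  have "{A. coeff (e_gen j) A \<noteq> 0} = {{j}}" by (auto simp: coeff_e_gen)
  then show ?thesis
    by (simp only: times_clifford.rep_eq) (simp add: coeff_e_gen)
qed

theorem e_gen_relation:
  "e_gen j * e_gen k + e_gen k * e_gen j = (if j = k then - 2 else 0)"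
proof (rule coeff_eqI)
  fix C
  have sgn: "clifford_sign {i} {l} = (if l \<le> i then - 1 else 1)" for i l :: nat
  proof -
    have "{(a, b). a \<in> {i} \<and> b \<in> {l} \<and> b \<le> a} = (if l \<le> i then {(i, l)} else {})" by auto
    then show ?thesis by (simp add: clifford_sign_def)
  qed
  have "(2 :: clifford) = 1 + 1" by simp
  then have two: "coeff 2 C = (if C = {} then 2 else 0)"
    by (simp only: coeff_simps) simp
  have iff: "sym_diff {i} C = {l} \<longleftrightarrow> C = sym_diff {i} {l}" for i l :: nat
    by blast
  have *: "coeff (e_gen i * e_gen l) C =
      (if C = sym_diff {i} {l} then if l \<le> i then - 1 else 1 else 0)" for i l
  proof -
    have "coeff (e_gen i * e_gen l) C = (if sym_diff {i} C = {l} then clifford_sign {i} {l} else 0)"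
      by (cases "sym_diff {i} C = {l}")
        (simp_all only: coeff_e_gen_mult coeff_e_gen if_True if_False mult_1_right mult_zero_right simp_thms)
    then show ?thesis by (simp only: iff sgn)
  qed
  have "sym_diff {k} {j} = sym_diff {j} {k}" by blast
  moreover have "j \<noteq> k \<Longrightarrow> (j \<le> k) = (\<not> k \<le> j)" by linarith
  ultimately show "coeff (e_gen j * e_gen k + e_gen k * e_gen j) C = coeff (if j = k then - 2 else 0) C"
    by (cases "j = k") (simp_all only: coeff_simps * if_True if_False, auto simp: two)
qed


lemma bounded_linear_scaleC_left: "bounded_linear (\<lambda>c. c *\<^sub>C (v :: 'v :: complex_normed_vector))"
  by (rule bounded_linear_intro[of _ "norm v"])
    (simp_all add: scaleC_add_left scaleC_scaleC scaleR_scaleC[where 'a = 'v] scaleR_conv_of_real norm_scaleC)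

lemma bounded_linear_scaleC_right: "bounded_linear (\<lambda>v. c *\<^sub>C (v :: 'v :: complex_normed_vector))"
  by (rule bounded_linear_intro[of _ "cmod c"])
    (simp_all add: scaleC_add_right scaleC_scaleC scaleR_scaleC[where 'a = 'v] norm_scaleC mult.commute)

lemmas scaleC_zero_left [simp] = linear_0[OF bounded_linear.linear[OF bounded_linear_scaleC_left]]
lemmas scaleC_zero_right [simp] = linear_0[OF bounded_linear.linear[OF bounded_linear_scaleC_right]]
lemmas scaleC_minus_left = linear_neg[OF bounded_linear.linear[OF bounded_linear_scaleC_left]]
lemmas scaleC_minus_right = linear_neg[OF bounded_linear.linear[OF bounded_linear_scaleC_right]]
lemmas scaleC_diff_left = linear_diff[OF bounded_linear.linear[OF bounded_linear_scaleC_left]]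
lemmas scaleC_diff_right = linear_diff[OF bounded_linear.linear[OF bounded_linear_scaleC_right]]
lemmas scaleC_sum_right = linear_sum[OF bounded_linear.linear[OF bounded_linear_scaleC_right]]

lemma scaleC_one [simp]: "1 *\<^sub>C (v :: 'v :: complex_normed_vector) = v"
  using scaleR_scaleC[of 1 v] by simp


section \<open>Partial derivatives\<close>

text \<open>
  Indices start at \<open>0\<close> throughout: the variables \<open>x\<^sub>1, \<dots>, x\<^bsub>2m\<^esub>\<close> are \<open>x 0, \<dots>, x (2 * m - 1)\<close>,
  and likewise for all other families.  Points of \<open>\<real>\<^sup>N\<close> are the elements of
  \<^term>\<open>topspace (Euclidean_space N)\<close>.
\<close>

definition partial_deriv :: "nat \<Rightarrow> ((nat \<Rightarrow> real) \<Rightarrow> 'v::real_normed_vector) \<Rightarrow> (nat \<Rightarrow> real) \<Rightarrow> 'v"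
  where "partial_deriv j f x = vector_derivative (\<lambda>t. f (x(j := t))) (at (x j))"

definition partially_differentiable ::
    "nat \<Rightarrow> ((nat \<Rightarrow> real) \<Rightarrow> 'v::real_normed_vector) \<Rightarrow> (nat \<Rightarrow> real) \<Rightarrow> bool"
  where "partially_differentiable j f x \<longleftrightarrow> (\<lambda>t. f (x(j := t))) differentiable (at (x j))"

text \<open>Only meaningful for \<open>\<Omega>\<close> open in \<open>\<real>\<^sup>N\<close>: otherwise values outside \<open>\<Omega>\<close> enter the derivatives.\<close>

definition C_infinity :: "nat \<Rightarrow> (nat \<Rightarrow> real) set \<Rightarrow> ((nat \<Rightarrow> real) \<Rightarrow> complex) \<Rightarrow> bool"
  where "C_infinity N \<Omega> f \<longleftrightarrow>
    (\<forall>js. set js \<subseteq> {..<N} \<longrightarrow>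
      continuous_map (subtopology (Euclidean_space N) \<Omega>) euclidean (foldr partial_deriv js f) \<and>
      (\<forall>j<N. \<forall>x\<in>\<Omega>. partially_differentiable j (foldr partial_deriv js f) x))"

lemma partial_deriv_bounded_linear:
  assumes "bounded_linear h" "partially_differentiable j f x"
  shows "partial_deriv j (\<lambda>y. h (f y)) x = h (partial_deriv j f x)"
    and "partially_differentiable j (\<lambda>y. h (f y)) x"
proof -
  have "((\<lambda>t. f (x(j := t))) has_vector_derivative partial_deriv j f x) (at (x j))"
    using assms(2) unfolding partial_deriv_def partially_differentiable_def
    by (simp add: vector_derivative_works)
  then have "((\<lambda>t. h (f (x(j := t)))) has_vector_derivative h (partial_deriv j f x)) (at (x j))"
    by (rule bounded_linear.has_vector_derivative[OF assms(1)])
  then show "partial_deriv j (\<lambda>y. h (f y)) x = h (partial_deriv j f x)"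
    and "partially_differentiable j (\<lambda>y. h (f y)) x"
    unfolding partial_deriv_def partially_differentiable_def
    by (auto simp: vector_derivative_at intro: differentiableI_vector)
qed


section \<open>Superfunctions\<close>

text \<open>
  A superfunction \<open>F = \<Sum>\<^sub>A F\<^sub>A \<xi>\<^sub>A\<close>, with \<open>\<xi>\<^sub>A\<close> the ordered monomials in the anticommuting variables
  \<open>\<xi>\<^sub>0, \<dots>, \<xi>\<^bsub>2n-1\<^esub>\<close>, is given by its coefficient functions \<open>F A\<close>.  The coefficient type is
  arbitrary so that the same operators act on Clifford-valued superfunctions.
\<close>

type_synonym 'v superfun = "nat set \<Rightarrow> (nat \<Rightarrow> real) \<Rightarrow> 'v"

definition superfunctions :: "nat \<Rightarrow> nat \<Rightarrow> (nat \<Rightarrow> real) set \<Rightarrow> complex superfun set"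
  where "superfunctions m n \<Omega> =
    {F. (\<forall>A. A \<subseteq> {..<2 * n} \<longrightarrow> C_infinity (2 * m) \<Omega> (F A)) \<and>
        (\<forall>A. \<not> A \<subseteq> {..<2 * n} \<longrightarrow> (\<forall>x\<in>\<Omega>. F A x = 0))}"

definition dx :: "nat \<Rightarrow> 'v::complex_normed_vector superfun \<Rightarrow> 'v superfun"
  where "dx j F = (\<lambda>A. partial_deriv j (F A))"

text \<open>
  Left multiplication by \<open>\<xi>\<^sub>j\<close> and the left derivative \<open>\<partial>\<^bsub>\<xi>j\<^esub>\<close>; the sign comes from moving
  \<open>\<xi>\<^sub>j\<close> past the variables with smaller index.  The characterising relations of the left
  derivative are \<open>dg_const\<close> and \<open>dg_gmult\<close> below.
\<close>

definition gmult :: "nat \<Rightarrow> 'v::complex_normed_vector superfun \<Rightarrow> 'v superfun"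
  where "gmult j F = (\<lambda>A x. if j \<in> A then (- 1) ^ card {k\<in>A. k < j} *\<^sub>C F (A - {j}) x else 0)"

definition dg :: "nat \<Rightarrow> 'v::complex_normed_vector superfun \<Rightarrow> 'v superfun"
  where "dg j F = (\<lambda>A x. if j \<in> A then 0 else (- 1) ^ card {k\<in>A. k < j} *\<^sub>C F (insert j A) x)"

lemma card_less_insert_remove:
  fixes A :: "nat set"
  shows "card {k \<in> insert j A. k < i} = card {k\<in>A. k < i} + (if j < i \<and> j \<notin> A then 1 else 0)"
    and "card {k\<in>A. k < i} = card {k \<in> A - {j}. k < i} + (if j < i \<and> j \<in> A then 1 else 0)"
proof -
  have ins: "card {k \<in> insert j B. k < i} = card {k\<in>B. k < i} + (if j < i \<and> j \<notin> B then 1 else 0)"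
    for B :: "nat set"
  proof (cases "j < i \<and> j \<notin> B")
    case True
    then have "{k \<in> insert j B. k < i} = insert j {k\<in>B. k < i}" by auto
    then show ?thesis using True by simp
  next
    case False
    then have "{k \<in> insert j B. k < i} = {k\<in>B. k < i}" by auto
    then show ?thesis using False by simp
  qed
  show "card {k \<in> insert j A. k < i} = card {k\<in>A. k < i} + (if j < i \<and> j \<notin> A then 1 else 0)"
    by (rule ins)
  show "card {k\<in>A. k < i} = card {k \<in> A - {j}. k < i} + (if j < i \<and> j \<in> A then 1 else 0)"
  proof (cases "j \<in> A")
    case True
    then show ?thesis using ins[of "A - {j}"] by (simp add: insert_absorb)
  qed simp
qed

theorem dg_const: "dg j (\<lambda>A x. if A = {} then c x else 0) = (\<lambda>_ _. 0)"
  by (auto simp: dg_def fun_eq_iff)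

theorem dg_gmult: "dg j (gmult k F) A x + gmult k (dg j F) A x = (if j = k then F A x else 0)"
proof -
  let ?s = "\<lambda>A j. (- 1 :: complex) ^ card {l\<in>A. l < (j :: nat)}"
  show ?thesis
  proof (cases "j = k")
    case True
    have "card {l\<in>insert j A. l < j} = card {l\<in>A. l < j}" "card {l\<in>A - {j}. l < j} = card {l\<in>A. l < j}"
      using card_less_insert_remove[where A = A and j = j and i = j] by simp_all
    then have "?s A j * ?s (insert j A) j = 1" "?s A j * ?s (A - {j}) j = 1"
      by (simp_all flip: power_mult_distrib)
    then show ?thesis
      using True by (simp add: dg_def gmult_def scaleC_scaleC insert_absorb)
  next
    case False
    show ?thesis
    proof (cases "j \<in> A \<or> k \<notin> A")
      case True
      then show ?thesis using False by (auto simp: dg_def gmult_def)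
    next
      case nA: False
      have F: "insert j A - {k} = insert j (A - {k})" using False by blast
      have "card {l\<in>insert j A. l < k} = card {l\<in>A. l < k} + (if j < k then 1 else 0)"
        "card {l\<in>A. l < j} = card {l\<in>A - {k}. l < j} + (if k < j then 1 else 0)"
        using card_less_insert_remove(1)[where A = A and j = j and i = k]
          card_less_insert_remove(2)[where A = A and j = k and i = j] nA by simp_all
      then have "?s A j * ?s (insert j A) k + ?s A k * ?s (A - {k}) j = 0"
        using False by (cases "j < k") (simp_all only: power_add power_one_right if_True if_False, auto)
      moreover have "dg j (gmult k F) A x + gmult k (dg j F) A x =
          (?s A j * ?s (insert j A) k + ?s A k * ?s (A - {k}) j) *\<^sub>C F (insert j (A - {k})) x"
        using nA False by (simp add: dg_def gmult_def scaleC_scaleC scaleC_add_left F)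
      ultimately show ?thesis using False by simp
    qed
  qed
qed

theorem gmult_ordered_monomial:
  assumes "sorted js" "distinct js"
  shows "foldr gmult js (\<lambda>A x. if A = {} then 1 else 0) = (\<lambda>A x. if A = set js then 1 :: complex else 0)"
  using assms
proof (induction js)
  case (Cons j js)
  then have lt: "\<forall>k\<in>set js. j < k" by (auto simp: le_less)
  have IH: "foldr gmult js (\<lambda>A x. if A = {} then 1 else 0) = (\<lambda>A x. if A = set js then 1 :: complex else 0)"
    using Cons by simp
  have "gmult j (\<lambda>A x. if A = set js then 1 :: complex else 0) A x = (if A = insert j (set js) then 1 else 0)"
    for A and x :: "nat \<Rightarrow> real"
  proof (cases "A = insert j (set js)")
    case True
    then have "{k\<in>A. k < j} = {}" "A - {j} = set js" "j \<in> A" using lt Cons.prems by auto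
    then have "gmult j (\<lambda>A x. if A = set js then 1 :: complex else 0) A x = 1"
      by (simp only: gmult_def) simp
    then show ?thesis using True by simp
  next
    case False
    then have "j \<in> A \<Longrightarrow> A - {j} \<noteq> set js" by blast
    then show ?thesis using False by (simp add: gmult_def)
  qed
  then show ?case by (simp add: IH fun_eq_iff)
qed simp

definition dz :: "nat \<Rightarrow> nat \<Rightarrow> 'v::complex_normed_vector superfun \<Rightarrow> 'v superfun"
  where "dz m j F = (\<lambda>A x. (1 / 2) *\<^sub>C (dx j F A x - \<i> *\<^sub>C dx (m + j) F A x))"

definition dzc :: "nat \<Rightarrow> nat \<Rightarrow> 'v::complex_normed_vector superfun \<Rightarrow> 'v superfun"
  where "dzc m j F = (\<lambda>A x. (1 / 2) *\<^sub>C (dx j F A x + \<i> *\<^sub>C dx (m + j) F A x))"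

definition dgz :: "nat \<Rightarrow> 'v::complex_normed_vector superfun \<Rightarrow> 'v superfun"
  where "dgz j F = (\<lambda>A x. (1 / 2) *\<^sub>C (dg (2 * j) F A x - \<i> *\<^sub>C dg (2 * j + 1) F A x))"

definition dgzc :: "nat \<Rightarrow> 'v::complex_normed_vector superfun \<Rightarrow> 'v superfun"
  where "dgzc j F = (\<lambda>A x. (1 / 2) *\<^sub>C (dg (2 * j) F A x + \<i> *\<^sub>C dg (2 * j + 1) F A x))"

definition super_holomorphic :: "nat \<Rightarrow> nat \<Rightarrow> (nat \<Rightarrow> real) set \<Rightarrow> complex superfun \<Rightarrow> bool"
  where "super_holomorphic m n \<Omega> F \<longleftrightarrow>
    (\<forall>j<m. \<forall>A. \<forall>x\<in>\<Omega>. dzc m j F A x = 0) \<and> (\<forall>k<n. \<forall>A. \<forall>x\<in>\<Omega>. dgzc k F A x = 0)"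


section \<open>Spinors\<close>

text \<open>
  Spinors are functions of the auxiliary variables \<open>a 0, \<dots>, a (n - 1)\<close> with values in the Clifford
  algebra generated by \<open>e\<^sub>0, \<dots>, e\<^bsub>2m\<^esub>\<close>; the last generator, \<^term>\<open>e_gen (2 * m)\<close>, is the
  additional one.  The orthogonal generators act by left multiplication.  In 1-based numbering
  \<^term>\<open>symp_gen m (2 * j)\<close> has the odd index \<open>2(j + 1) - 1\<close> and acts as a derivative, while
  \<^term>\<open>symp_gen m (2 * j + 1)\<close> has the even index \<open>2(j + 1)\<close>.
\<close>

type_synonym spinor = "(nat \<Rightarrow> real) \<Rightarrow> clifford"

definition symp_gen :: "nat \<Rightarrow> nat \<Rightarrow> spinor \<Rightarrow> spinor"
  where "symp_gen m k s = (\<lambda>a. if even k then e_gen (2 * m) * partial_deriv (k div 2) s a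
    else - (a (k div 2) *\<^sub>R (e_gen (2 * m) * s a)))"

lemma partial_deriv_coordinate_scaleR:
  assumes "partially_differentiable j s a"
  shows "partial_deriv j (\<lambda>b. b k *\<^sub>R s b) a = a k *\<^sub>R partial_deriv j s a + (if j = k then s a else 0)"
    and "partially_differentiable j (\<lambda>b. b k *\<^sub>R s b) a"
proof -
  have s: "((\<lambda>t. s (a(j := t))) has_vector_derivative partial_deriv j s a) (at (a j))"
    using assms unfolding partial_deriv_def partially_differentiable_def
    by (simp add: vector_derivative_works)
  have k: "((\<lambda>t. (a(j := t)) k) has_real_derivative (if j = k then 1 else 0)) (at (a j))"
    by (cases "j = k") (auto intro: derivative_eq_intros)
  have "((\<lambda>t. (a(j := t)) k *\<^sub>R s (a(j := t))) has_vector_derivative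
      a k *\<^sub>R partial_deriv j s a + (if j = k then s a else 0)) (at (a j))"
    using has_vector_derivative_scaleR[OF k s] by (simp cong: if_cong split: if_splits)
  then show "partial_deriv j (\<lambda>b. b k *\<^sub>R s b) a = a k *\<^sub>R partial_deriv j s a + (if j = k then s a else 0)"
    and "partially_differentiable j (\<lambda>b. b k *\<^sub>R s b) a"
    unfolding partial_deriv_def partially_differentiable_def
    by (auto simp: vector_derivative_at intro: differentiableI_vector)
qed

lemma e_gen_square: "e_gen k * e_gen k = - 1"
proof -
  have "(2 :: real) *\<^sub>R (e_gen k * e_gen k) = 2 *\<^sub>R (- 1)"
    using e_gen_relation[of k k] by (simp add: scaleR_2)
  then show ?thesis by (metis scaleR_cancel_left zero_neq_numeral)
qed

theorem symp_gen_relations: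
  assumes "partially_differentiable j s a"
  shows "symp_gen m (2 * j) (symp_gen m (2 * k + 1) s) a - symp_gen m (2 * k + 1) (symp_gen m (2 * j) s) a
      = (if j = k then s a else 0)"
    and "symp_gen m (2 * j + 1) (symp_gen m (2 * k + 1) s) a
      - symp_gen m (2 * k + 1) (symp_gen m (2 * j + 1) s) a = 0"
    and "i < 2 * m \<Longrightarrow> e_gen i * symp_gen m (2 * j) s a + symp_gen m (2 * j) (\<lambda>b. e_gen i * s b) a = 0"
    and "i < 2 * m \<Longrightarrow> e_gen i * symp_gen m (2 * k + 1) s a + symp_gen m (2 * k + 1) (\<lambda>b. e_gen i * s b) a = 0"
proof -
  let ?e = "e_gen (2 * m)"
  have sq: "?e * (?e * v) = - v" for v
    by (metis e_gen_square mult.assoc mult_minus1)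
  have es: "partially_differentiable j (\<lambda>b. ?e * s b) a"
    and es': "partial_deriv j (\<lambda>b. ?e * s b) a = ?e * partial_deriv j s a"
    using partial_deriv_bounded_linear[OF bounded_linear_mult_right[of ?e] assms] by auto
  have "partial_deriv j (\<lambda>b. - (b k *\<^sub>R (?e * s b))) a
    = - (a k *\<^sub>R (?e * partial_deriv j s a) + (if j = k then ?e * s a else 0))"
    using partial_deriv_bounded_linear(1)[OF bounded_linear_minus[OF bounded_linear_ident]
        partial_deriv_coordinate_scaleR(2)[OF es]]
    by (simp only: partial_deriv_coordinate_scaleR(1)[OF es] es')
  then show "symp_gen m (2 * j) (symp_gen m (2 * k + 1) s) a - symp_gen m (2 * k + 1) (symp_gen m (2 * j) s) a
      = (if j = k then s a else 0)"
    by (simp add: symp_gen_def) (simp add: right_diff_distrib sq)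
  show "symp_gen m (2 * j + 1) (symp_gen m (2 * k + 1) s) a
      - symp_gen m (2 * k + 1) (symp_gen m (2 * j + 1) s) a = 0"
    by (simp add: symp_gen_def mult.commute)
  assume "i < 2 * m"
  then have "e_gen i * ?e = - (?e * e_gen i)"
    using e_gen_relation[of i "2 * m"] by (simp add: add_eq_0_iff2)
  then have ac: "e_gen i * (?e * v) = - (?e * (e_gen i * v))" for v
    by (metis mult.assoc mult_minus_left)
  show "e_gen i * symp_gen m (2 * j) s a + symp_gen m (2 * j) (\<lambda>b. e_gen i * s b) a = 0"
    using partial_deriv_bounded_linear(1)[OF bounded_linear_mult_right[of "e_gen i"] assms]
    by (simp add: symp_gen_def ac)
  show "e_gen i * symp_gen m (2 * k + 1) s a + symp_gen m (2 * k + 1) (\<lambda>b. e_gen i * s b) a = 0"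
    by (simp add: symp_gen_def ac)
qed

theorem symp_gen_relation_derivatives:
  assumes "partially_differentiable j (partial_deriv k s) a" "partially_differentiable k (partial_deriv j s) a"
    and "partial_deriv j (partial_deriv k s) a = partial_deriv k (partial_deriv j s) a"
  shows "symp_gen m (2 * j) (symp_gen m (2 * k) s) a - symp_gen m (2 * k) (symp_gen m (2 * j) s) a = 0"
  using partial_deriv_bounded_linear(1)[OF bounded_linear_mult_right assms(1)]
    partial_deriv_bounded_linear(1)[OF bounded_linear_mult_right assms(2)] assms(3)
  by (simp add: symp_gen_def)

definition witt_f :: "nat \<Rightarrow> nat \<Rightarrow> clifford"
  where "witt_f m j = (1 / 2) *\<^sub>C (e_gen j - \<i> *\<^sub>C e_gen (m + j))"

definition witt_f_dag :: "nat \<Rightarrow> nat \<Rightarrow> clifford"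
  where "witt_f_dag m j = - ((1 / 2) *\<^sub>C (e_gen j + \<i> *\<^sub>C e_gen (m + j)))"

definition symp_f :: "nat \<Rightarrow> nat \<Rightarrow> spinor \<Rightarrow> spinor"
  where "symp_f m j s =
    (\<lambda>a. (1 / 2) *\<^sub>C (symp_gen m (2 * j) s a - \<i> *\<^sub>C symp_gen m (2 * j + 1) s a))"

definition symp_f_dag :: "nat \<Rightarrow> nat \<Rightarrow> spinor \<Rightarrow> spinor"
  where "symp_f_dag m j s =
    (\<lambda>a. - ((1 / 2) *\<^sub>C (symp_gen m (2 * j) s a + \<i> *\<^sub>C symp_gen m (2 * j + 1) s a)))"

definition I_b :: "nat \<Rightarrow> clifford"
  where "I_b m = prod_list (map (\<lambda>j. witt_f_dag m j * witt_f m j) [0..<m])"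

definition I_f :: "nat \<Rightarrow> (nat \<Rightarrow> real) \<Rightarrow> complex"
  where "I_f n a = exp (\<i> / 2 * (\<Sum>j<n. (of_real (a j))\<^sup>2))"

definition spinor_superfun :: "nat \<Rightarrow> nat \<Rightarrow> complex superfun \<Rightarrow> spinor superfun"
  where "spinor_superfun m n F = (\<lambda>A x a. F A x *\<^sub>C I_f n a *\<^sub>C I_b m)"


section \<open>The Hermitian Dirac operators\<close>

text \<open>Derivatives with respect to the superspace variables, acting with the spinor variables fixed.\<close>

definition on_spinors :: "(clifford superfun \<Rightarrow> clifford superfun) \<Rightarrow> spinor superfun \<Rightarrow> spinor superfun"
  where "on_spinors D \<Phi> = (\<lambda>A x a. D (\<lambda>B y. \<Phi> B y a) A x)"

definition dirac_Z :: "nat \<Rightarrow> nat \<Rightarrow> spinor superfun \<Rightarrow> spinor superfun"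
  where "dirac_Z m n \<Phi> = (\<lambda>A x a.
    (\<Sum>j<m. witt_f_dag m j * on_spinors (dz m j) \<Phi> A x a)
    + (2 * \<i>) *\<^sub>C (\<Sum>j<n. symp_f_dag m j (on_spinors (dgz j) \<Phi> A x) a))"

definition dirac_Z_dag :: "nat \<Rightarrow> nat \<Rightarrow> spinor superfun \<Rightarrow> spinor superfun"
  where "dirac_Z_dag m n \<Phi> = (\<lambda>A x a.
    (\<Sum>j<m. witt_f m j * on_spinors (dzc m j) \<Phi> A x a)
    - (2 * \<i>) *\<^sub>C (\<Sum>j<n. symp_f m j (on_spinors (dgzc j) \<Phi> A x) a))"

definition sh_monogenic :: "nat \<Rightarrow> nat \<Rightarrow> (nat \<Rightarrow> real) set \<Rightarrow> spinor superfun \<Rightarrow> bool"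
  where "sh_monogenic m n \<Omega> \<Phi> \<longleftrightarrow>
    (\<forall>A. \<forall>x\<in>\<Omega>. \<forall>a\<in>topspace (Euclidean_space n). dirac_Z m n \<Phi> A x a = 0 \<and> dirac_Z_dag m n \<Phi> A x a = 0)"

lemma symp_gen_scaleC:
  assumes "partially_differentiable (k div 2) s a"
  shows "symp_gen m k (\<lambda>b. c *\<^sub>C s b) a = c *\<^sub>C symp_gen m k s a"
  using partial_deriv_bounded_linear(1)[OF bounded_linear_scaleC_right[of c] assms]
  by (simp add: symp_gen_def clifford_mult_scaleC scaleC_minus_right
      scaleR_scaleC[where 'a = clifford] scaleC_scaleC mult.commute)

theorem dirac_on_simple_tensors:
  assumes F: "\<And>j. j < 2 * m \<Longrightarrow> partially_differentiable j (F A) x"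
    and s: "\<And>j. j < n \<Longrightarrow> partially_differentiable j s a"
  shows "dirac_Z m n (\<lambda>A x a. F A x *\<^sub>C s a) A x a =
      (\<Sum>j<m. dz m j F A x *\<^sub>C (witt_f_dag m j * s a))
      + (2 * \<i>) *\<^sub>C (\<Sum>j<n. dgz j F A x *\<^sub>C symp_f_dag m j s a)"
    and "dirac_Z_dag m n (\<lambda>A x a. F A x *\<^sub>C s a) A x a =
      (\<Sum>j<m. dzc m j F A x *\<^sub>C (witt_f m j * s a))
      - (2 * \<i>) *\<^sub>C (\<Sum>j<n. dgzc j F A x *\<^sub>C symp_f m j s a)"
proof -
  have dx: "dx j (\<lambda>B y. F B y *\<^sub>C s a) A x = dx j F A x *\<^sub>C s a" if "j < 2 * m" for j
    unfolding dx_def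
    by (rule partial_deriv_bounded_linear(1)[OF bounded_linear_scaleC_left F[OF that]])
  have z: "on_spinors (dz m j) (\<lambda>A x a. F A x *\<^sub>C s a) A x a = dz m j F A x *\<^sub>C s a"
    "on_spinors (dzc m j) (\<lambda>A x a. F A x *\<^sub>C s a) A x a = dzc m j F A x *\<^sub>C s a"
    if "j < m" for j
    using that by (simp_all add: on_spinors_def dz_def dzc_def dx scaleC_complex_def
        scaleC_add_left scaleC_diff_left scaleC_scaleC scaleC_add_right scaleC_diff_right algebra_simps)
  have g: "on_spinors (dgz j) (\<lambda>A x a. F A x *\<^sub>C s a) A x = (\<lambda>a. dgz j F A x *\<^sub>C s a)"
    "on_spinors (dgzc j) (\<lambda>A x a. F A x *\<^sub>C s a) A x = (\<lambda>a. dgzc j F A x *\<^sub>C s a)" for j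
    by (auto simp: on_spinors_def dgz_def dgzc_def dg_def scaleC_complex_def scaleC_scaleC fun_eq_iff
        scaleC_add_left scaleC_diff_left scaleC_add_right scaleC_diff_right algebra_simps)
  have f: "symp_f_dag m j (\<lambda>a. c *\<^sub>C s a) a = c *\<^sub>C symp_f_dag m j s a"
    "symp_f m j (\<lambda>a. c *\<^sub>C s a) a = c *\<^sub>C symp_f m j s a" if "j < n" for j c
    using that by (simp_all add: symp_f_def symp_f_dag_def symp_gen_scaleC s scaleC_scaleC
        scaleC_minus_right scaleC_add_right scaleC_diff_right mult.commute)
  show "dirac_Z m n (\<lambda>A x a. F A x *\<^sub>C s a) A x a =
      (\<Sum>j<m. dz m j F A x *\<^sub>C (witt_f_dag m j * s a))
      + (2 * \<i>) *\<^sub>C (\<Sum>j<n. dgz j F A x *\<^sub>C symp_f_dag m j s a)"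
    and "dirac_Z_dag m n (\<lambda>A x a. F A x *\<^sub>C s a) A x a =
      (\<Sum>j<m. dzc m j F A x *\<^sub>C (witt_f m j * s a))
      - (2 * \<i>) *\<^sub>C (\<Sum>j<n. dgzc j F A x *\<^sub>C symp_f m j s a)"
    by (simp_all add: dirac_Z_def dirac_Z_dag_def z g f clifford_mult_scaleC)
qed

end

theory Submission
  imports Defs
begin

text \<open>
  The vector \<open>I\<^sub>b\<close> is annihilated by every \<open>\<ff>\<^sub>j\<^sup>\<dagger>\<close>, and the Gaussian \<open>I\<^sub>f\<close> by every symplectic
  \<open>\<ff>\<^sub>j\<^sup>\<dagger>\<close>, while the symplectic \<open>\<ff>\<^sub>j\<close> multiplies \<open>I\<^sub>f\<close> by \<open>\<i> a\<^sub>j e\<^bsub>2m+1\<^esub>\<close>.  Hence the first Dirac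
  equation always holds, and the second one reads
  \<open>\<Sum>\<^sub>j (\<partial>\<^bsub>z\<^sub>j\<^sup>c\<^esub> F) \<ff>\<^sub>j I\<^sub>b + 2 \<Sum>\<^sub>k a\<^sub>k (\<partial>\<^bsub>\<zeta>\<^sub>k\<^sup>c\<^esub> F) e\<^bsub>2m+1\<^esub> I\<^sub>b = 0\<close> for all \<open>a\<close>, with \<open>\<zeta>\<^sub>k\<close> the
  anticommuting complex variables.  At \<open>a = 0\<close>, left multiplication by \<open>\<ff>\<^sub>k\<^sup>\<dagger>\<close> isolates the \<open>k\<close>-th
  term of the first sum; the unit vectors \<open>a\<close> then give the terms of the second.
\<close>

section \<open>The Witt basis\<close>

text \<open>By bilinearity, an anticommutator of two vectors of Witt shape reduces to
  anticommutators of generators, where \<open>e_gen_relation\<close> applies;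
  \<open>witt_alt\<close> supplies that shape.\<close>

lemma anticommutator_expand:
  fixes a b c d :: clifford
  shows "(s *\<^sub>C (a + p *\<^sub>C b)) * (t *\<^sub>C (c + q *\<^sub>C d)) + (t *\<^sub>C (c + q *\<^sub>C d)) * (s *\<^sub>C (a + p *\<^sub>C b)) =
    (s * t) *\<^sub>C ((a * c + c * a) + q *\<^sub>C (a * d + d * a) + p *\<^sub>C (b * c + c * b)
      + (p * q) *\<^sub>C (b * d + d * b))"
  by (simp add: clifford_mult_scaleC scaleC_add_right scaleC_scaleC distrib_left distrib_right
      mult.commute mult.left_commute add_ac)

lemma clifford_two_scaleC: "(2 :: clifford) = 2 *\<^sub>C 1"
  using scaleR_scaleC[of 2 "1 :: clifford"] by (simp add: scaleR_2)

lemma witt_alt: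
  "witt_f m j = (1 / 2) *\<^sub>C (e_gen j + (- \<i>) *\<^sub>C e_gen (m + j))"
  "witt_f_dag m j = (- (1 / 2)) *\<^sub>C (e_gen j + \<i> *\<^sub>C e_gen (m + j))"
  by (simp_all only: witt_f_def witt_f_dag_def scaleC_minus_left diff_conv_add_uminus)

lemma witt_anticommute:
  assumes "j < m" "k < m"
  shows "witt_f_dag m j * witt_f_dag m k + witt_f_dag m k * witt_f_dag m j = 0"
    and "witt_f m j * witt_f m k + witt_f m k * witt_f m j = 0"
    and "witt_f_dag m j * witt_f m k + witt_f m k * witt_f_dag m j = (if j = k then 1 else 0)"
  using assms unfolding witt_alt anticommutator_expand e_gen_relation
  by (auto simp: clifford_two_scaleC scaleC_scaleC scaleC_add_right scaleC_minus_right
      simp flip: scaleC_minus_left scaleC_add_left)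

lemma witt_f_dag_square:
  assumes "j < m"
  shows "witt_f_dag m j * witt_f_dag m j = 0"
proof -
  have "(2 :: real) *\<^sub>R (witt_f_dag m j * witt_f_dag m j) = 0"
    using witt_anticommute(1)[OF assms assms] by (simp add: scaleR_2)
  then show ?thesis by simp
qed

lemma anticommute_commute_mult:
  fixes a b c :: "'a :: ring"
  assumes "a * b + b * a = 0" "a * c + c * a = 0"
  shows "a * (b * c) = b * c * a"
proof -
  have "a * b = - (b * a)" "a * c = - (c * a)" using assms by (simp_all add: add_eq_0_iff2)
  then show ?thesis by (metis minus_mult_minus mult.assoc mult_minus_left mult_minus_right minus_minus)
qed

lemma commute_prod_list:
  fixes a :: "'a :: monoid_mult"
  assumes "\<And>x. x \<in> set xs \<Longrightarrow> a * x = x * a"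
  shows "a * prod_list xs = prod_list xs * a"
  using assms
proof (induction xs)
  case (Cons x xs)
  have "a * (x * prod_list xs) = x * (a * prod_list xs)"
    using Cons.prems[of x] by (metis list.set_intros(1) mult.assoc)
  also have "\<dots> = x * (prod_list xs * a)" using Cons by simp
  finally show ?case by (simp add: mult.assoc)
qed simp

text \<open>For distinct indices each Witt vector anticommutes with both factors, and the two signs
  cancel.\<close>

lemma witt_commute:
  assumes "j < m" "k < m" "j \<noteq> k"
  shows "witt_f_dag m k * (witt_f_dag m j * witt_f m j) = witt_f_dag m j * witt_f m j * witt_f_dag m k"
    and "witt_f m k * (witt_f_dag m j * witt_f m j) = witt_f_dag m j * witt_f m j * witt_f m k"
  using assms
  by (intro anticommute_commute_mult; simp add: witt_anticommute; metis add.commute witt_anticommute(3))+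

lemma witt_prod_commute:
  assumes "k < m" "set js \<subseteq> {..<m} - {k}"
  shows "witt_f_dag m k * prod_list (map (\<lambda>j. witt_f_dag m j * witt_f m j) js) =
      prod_list (map (\<lambda>j. witt_f_dag m j * witt_f m j) js) * witt_f_dag m k"
    and "witt_f m k * prod_list (map (\<lambda>j. witt_f_dag m j * witt_f m j) js) =
      prod_list (map (\<lambda>j. witt_f_dag m j * witt_f m j) js) * witt_f m k"
  using assms by (auto intro!: commute_prod_list witt_commute)

text \<open>Moved past the factors of index below \<open>k\<close>, \<open>witt_f_dag m k\<close>
  meets its own copy, and its square is zero.\<close>

lemma witt_f_dag_I_b:
  assumes "k < m"
  shows "witt_f_dag m k * I_b m = 0"
proof -
  let ?P = "\<lambda>js. prod_list (map (\<lambda>j. witt_f_dag m j * witt_f m j) js)"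
  have "[0..<m] = [0..<k] @ k # [Suc k..<m]"
    using assms by (metis le_add_diff_inverse less_imp_le upt_add_eq_append upt_conv_Cons zero_le)
  then have "I_b m = ?P [0..<k] * (witt_f_dag m k * witt_f m k * ?P [Suc k..<m])"
    by (simp add: I_b_def)
  moreover have "witt_f_dag m k * ?P [0..<k] = ?P [0..<k] * witt_f_dag m k"
    using assms by (intro witt_prod_commute) auto
  ultimately have "witt_f_dag m k * I_b m =
      ?P [0..<k] * (witt_f_dag m k * witt_f_dag m k) * (witt_f m k * ?P [Suc k..<m])"
    by (simp only: flip: mult.assoc)
  then show ?thesis using witt_f_dag_square[OF assms] by simp
qed

lemma witt_f_dag_f_I_b:
  assumes "j < m" "k < m"
  shows "witt_f_dag m k * (witt_f m j * I_b m) = (if j = k then I_b m else 0)"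
proof -
  have "witt_f_dag m k * (witt_f m j * I_b m) + witt_f m j * (witt_f_dag m k * I_b m)
      = (witt_f_dag m k * witt_f m j + witt_f m j * witt_f_dag m k) * I_b m"
    by (simp add: distrib_right mult.assoc)
  then show ?thesis
    using assms by (simp add: witt_anticommute witt_f_dag_I_b)
qed

text \<open>
  If \<open>u f\<^sup>\<dagger> f = 0\<close> and \<open>f\<close> commutes with \<open>u\<close>, then \<open>u f\<^sup>\<dagger> = u f\<^sup>\<dagger> f f\<^sup>\<dagger> = 0\<close> and
  \<open>u = u f\<^sup>\<dagger> f + f u f\<^sup>\<dagger> = 0\<close>, so no factor of \<open>I\<^sub>b\<close> annihilates the product of its predecessors.
\<close>

lemma I_b_nonzero: "I_b m \<noteq> 0"
proof -
  let ?P = "\<lambda>js. prod_list (map (\<lambda>j. witt_f_dag m j * witt_f m j) js)"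
  have "?P [0..<k] \<noteq> 0" if "k \<le> m" for k
    using that
  proof (induction k)
    case (Suc k)
    let ?u = "?P [0..<k]" and ?f = "witt_f m k" and ?d = "witt_f_dag m k"
    have u: "?u \<noteq> 0" and k: "k < m" using Suc by auto
    have one: "?d * ?f + ?f * ?d = 1" using witt_anticommute(3)[OF k k] by simp
    have comm: "?f * ?u = ?u * ?f" using k by (intro witt_prod_commute) auto
    show ?case
    proof
      assume "?P [0..<Suc k] = 0"
      then have 0: "?u * (?d * ?f) = 0" by simp
      have "?d = ?d * (?d * ?f + ?f * ?d)" by (simp add: one)
      also have "\<dots> = ?d * ?f * ?d"
        using witt_f_dag_square[OF k] by (simp add: distrib_left flip: mult.assoc)
      finally have "?u * ?d = ?u * (?d * ?f) * ?d" by (simp only: mult.assoc)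
      with 0 have "?u * ?d = 0" by simp
      moreover have "?u * (?f * ?d) = ?f * (?u * ?d)" by (simp only: comm flip: mult.assoc)
      ultimately have "?u * (?f * ?d) = 0" by simp
      with 0 have "?u * (?d * ?f + ?f * ?d) = 0" by (simp add: distrib_left)
      with one u show False by simp
    qed
  qed simp
  then show ?thesis by (simp add: I_b_def)
qed

text \<open>A generator is invertible, since its square is -1.\<close>

lemma e_gen_mult_nonzero:
  assumes "u \<noteq> 0"
  shows "e_gen k * u \<noteq> 0"
  using assms by (metis e_gen_square mult.assoc mult_minus1 mult_zero_right neg_equal_0_iff_equal)

lemma scaleC_eq_0_iff [simp]: "c *\<^sub>C v = 0 \<longleftrightarrow> c = 0 \<or> v = (0 :: 'v :: complex_normed_vector)"
  by (metis mult_eq_0_iff norm_eq_zero norm_scaleC)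

lemma witt_f_I_b_independent:
  assumes "(\<Sum>j<m. c j *\<^sub>C (witt_f m j * I_b m)) = 0" "k < m"
  shows "c k = 0"
proof -
  have "0 = witt_f_dag m k * (\<Sum>j<m. c j *\<^sub>C (witt_f m j * I_b m))"
    using assms by simp
  also have "\<dots> = (\<Sum>j<m. if j = k then c k *\<^sub>C I_b m else 0)"
    unfolding sum_distrib_left clifford_mult_scaleC
    using assms(2) by (intro sum.cong) (auto simp: witt_f_dag_f_I_b)
  also have "\<dots> = c k *\<^sub>C I_b m" using assms(2) by simp
  finally show ?thesis using I_b_nonzero[of m] by auto
qed


section \<open>The Gaussian\<close>

lemma I_f_has_vector_derivative:
  assumes "j < n"
  shows "((\<lambda>t. I_f n (a(j := t))) has_vector_derivative (\<i> * of_real (a j)) * I_f n a) (at (a j))"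
proof -
  let ?C = "\<Sum>k\<in>{..<n} - {j}. (complex_of_real (a k))\<^sup>2"
  have I: "I_f n (a(j := t)) = exp (\<i> / 2 * ((of_real t)\<^sup>2 + ?C))" for t
    using assms by (simp add: I_f_def sum.remove[of "{..<n}" j])
  \<comment> \<open>The squares of the other coordinates form a constant \<open>?C\<close>; the
    exponential is differentiated in a complex variable and then restricted to the real
    line.\<close>
  have "((\<lambda>z. exp (\<i> / 2 * (z\<^sup>2 + ?C))) has_field_derivative
      (\<i> * of_real (a j)) * exp (\<i> / 2 * ((of_real (a j))\<^sup>2 + ?C))) (at (of_real (a j)))"
    by (auto intro!: derivative_eq_intros)
  from has_vector_derivative_real_field[OF this]
  show ?thesis
    using I[of "a j"] by (simp add: I)
qed

lemma gaussian_partial_deriv: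
  assumes "j < n"
  shows "partially_differentiable j (\<lambda>a. I_f n a *\<^sub>C v) a"
    and "partial_deriv j (\<lambda>a. I_f n a *\<^sub>C v) a = (\<i> * of_real (a j) * I_f n a) *\<^sub>C v"
proof -
  have "((\<lambda>t. I_f n (a(j := t)) *\<^sub>C v) has_vector_derivative (\<i> * of_real (a j) * I_f n a) *\<^sub>C v) (at (a j))"
    by (rule bounded_linear.has_vector_derivative[OF bounded_linear_scaleC_left
        I_f_has_vector_derivative[OF assms]])
  then show "partially_differentiable j (\<lambda>a. I_f n a *\<^sub>C v) a"
    and "partial_deriv j (\<lambda>a. I_f n a *\<^sub>C v) a = (\<i> * of_real (a j) * I_f n a) *\<^sub>C v"
    by (auto simp: partially_differentiable_def partial_deriv_def vector_derivative_at
        intro: differentiableI_vector)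
qed

text \<open>Differentiation brings down i times \<open>a j\<close> and the odd generator multiplies
  by minus \<open>a j\<close>, so the two terms cancel in \<open>symp_f_dag\<close> and add up in
  \<open>symp_f\<close>.\<close>

lemma symp_f_gaussian:
  assumes "j < n"
  shows "symp_f_dag m j (\<lambda>a. I_f n a *\<^sub>C v) a = 0"
    and "symp_f m j (\<lambda>a. I_f n a *\<^sub>C v) a = (\<i> * of_real (a j) * I_f n a) *\<^sub>C (e_gen (2 * m) * v)"
  by (simp_all add: symp_f_def symp_f_dag_def symp_gen_def gaussian_partial_deriv[OF assms]
      clifford_mult_scaleC scaleR_scaleC[where 'a = clifford] scaleC_scaleC scaleC_minus_right
      mult_ac flip: scaleC_add_left)


section \<open>The Dirac operators on spinor-valued superfunctions\<close>

lemma eventually_fun_upd_in_open: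
  assumes "openin (Euclidean_space N) \<Omega>" "x \<in> \<Omega>" "j < N"
  shows "eventually (\<lambda>t. x(j := t) \<in> \<Omega>) (nhds (x j))"
proof -
  have x: "x \<in> topspace (Euclidean_space N)" using assms openin_subset by blast
  have "continuous_map euclideanreal (Euclidean_space N) (\<lambda>t. x(j := t))"
    using x assms(3) unfolding Euclidean_space_def
    by (auto simp: continuous_map_in_subtopology continuous_map_componentwise_UNIV)
  from openin_continuous_map_preimage[OF this assms(1)]
  have "open {t. x(j := t) \<in> \<Omega>}" by simp
  then show ?thesis
    unfolding eventually_nhds using assms(2) by (intro exI[of _ "{t. x(j := t) \<in> \<Omega>}"]) simp
qed

lemma superfunction_partially_differentiable:
  assumes "openin (Euclidean_space (2 * m)) \<Omega>" "F \<in> superfunctions m n \<Omega>" "x \<in> \<Omega>" "j < 2 * m"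
  shows "partially_differentiable j (F A) x"
proof (cases "A \<subseteq> {..<2 * n}")
  case True
  then have "C_infinity (2 * m) \<Omega> (F A)" using assms(2) by (auto simp: superfunctions_def)
  then show ?thesis
    using assms(3,4) unfolding C_infinity_def by (elim allE[of _ "[]"]) simp
next
  case False
  then have 0: "\<And>y. y \<in> \<Omega> \<Longrightarrow> F A y = 0" using assms(2) by (auto simp: superfunctions_def)
  \<comment> \<open>The coefficient is known to vanish on \<Omega> only, so openness is needed to
    make it zero near \<open>x j\<close> along the coordinate line.\<close>
  have "eventually (\<lambda>t. F A (x(j := t)) = 0) (nhds (x j))"
    using eventually_fun_upd_in_open[OF assms(1,3,4)] by eventually_elim (rule 0)
  then have "((\<lambda>t. F A (x(j := t))) has_vector_derivative 0) (at (x j))"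
    using has_vector_derivative_cong_ev[of UNIV "\<lambda>t. F A (x(j := t))" "\<lambda>_. 0" "x j" 0]
      0[OF assms(3)]
    by (auto elim: eventually_mono)
  then show ?thesis
    by (auto simp: partially_differentiable_def intro: differentiableI_vector)
qed

lemma dirac_spinor_superfun:
  assumes "\<And>j. j < 2 * m \<Longrightarrow> partially_differentiable j (F A) x"
  shows "dirac_Z m n (spinor_superfun m n F) A x a = 0"
    and "dirac_Z_dag m n (spinor_superfun m n F) A x a =
      I_f n a *\<^sub>C ((\<Sum>j<m. dzc m j F A x *\<^sub>C (witt_f m j * I_b m))
        + (\<Sum>j<n. (2 * of_real (a j) * dgzc j F A x) *\<^sub>C (e_gen (2 * m) * I_b m)))"
proof -
  note dirac = dirac_on_simple_tensors[where m = m and n = n and F = F and A = A and x = x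
      and s = "\<lambda>a. I_f n a *\<^sub>C I_b m" and a = a, OF assms gaussian_partial_deriv(1),
      folded spinor_superfun_def]
  show "dirac_Z m n (spinor_superfun m n F) A x a = 0"
    by (simp add: dirac(1) clifford_mult_scaleC witt_f_dag_I_b symp_f_gaussian)
  show "dirac_Z_dag m n (spinor_superfun m n F) A x a =
      I_f n a *\<^sub>C ((\<Sum>j<m. dzc m j F A x *\<^sub>C (witt_f m j * I_b m))
        + (\<Sum>j<n. (2 * of_real (a j) * dgzc j F A x) *\<^sub>C (e_gen (2 * m) * I_b m)))"
    \<comment> \<open>The factor 2 arises as -(2i) times i, the second i coming from
      \<open>symp_f\<close> on the Gaussian.\<close>
    by (simp add: dirac(2) clifford_mult_scaleC symp_f_gaussian scaleC_sum_right scaleC_scaleC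
        scaleC_add_right diff_conv_add_uminus mult_ac
        flip: sum_negf scaleC_minus_left)
qed

lemma I_f_nonzero [simp]: "I_f n a \<noteq> 0"
  by (simp add: I_f_def)

theorem proposition5:
  fixes m n :: nat and \<Omega> :: "(nat \<Rightarrow> real) set" and F :: "complex superfun"
  assumes "m \<ge> 1"
    and "openin (Euclidean_space (2 * m)) \<Omega>"
    and "F \<in> superfunctions m n \<Omega>"
  shows "super_holomorphic m n \<Omega> F \<longleftrightarrow> sh_monogenic m n \<Omega> (spinor_superfun m n F)"
proof
  note dirac = dirac_spinor_superfun[OF superfunction_partially_differentiable[OF assms(2,3)]]
  show "sh_monogenic m n \<Omega> (spinor_superfun m n F)" if "super_holomorphic m n \<Omega> F"
    using that by (simp add: sh_monogenic_def super_holomorphic_def dirac)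
  assume mono: "sh_monogenic m n \<Omega> (spinor_superfun m n F)"
  have "(\<forall>j<m. dzc m j F A x = 0) \<and> (\<forall>k<n. dgzc k F A x = 0)" if x: "x \<in> \<Omega>" for A x
  proof -
    let ?S = "\<Sum>j<m. dzc m j F A x *\<^sub>C (witt_f m j * I_b m)"
    let ?v = "e_gen (2 * m) * I_b m"
    \<comment> \<open>The common factor \<open>I_f n a\<close> is never zero and cancels.\<close>
    have eq: "?S + (\<Sum>j<n. (2 * of_real (a j) * dgzc j F A x) *\<^sub>C ?v) = 0"
      if "a \<in> topspace (Euclidean_space n)" for a
      using mono x that by (simp add: sh_monogenic_def dirac)
    have S: "?S = 0"
      using eq[of "\<lambda>_. 0"] by (simp add: topspace_Euclidean_space)
    have "dgzc k F A x = 0" if k: "k < n" for k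
    proof -
      \<comment> \<open>Since \<open>k < n\<close>, this unit vector vanishes from index
        \<open>n\<close> on and so is an admissible point.\<close>
      let ?a = "\<lambda>i. if i = k then 1 else 0 :: real"
      have "(\<Sum>j<n. (2 * of_real (?a j) * dgzc j F A x) *\<^sub>C ?v)
          = (\<Sum>j<n. if j = k then (2 * dgzc k F A x) *\<^sub>C ?v else 0)"
        by (rule sum.cong) auto
      then have "(2 * dgzc k F A x) *\<^sub>C ?v = 0"
        using eq[of ?a] S k by (simp add: topspace_Euclidean_space)
      then show ?thesis using e_gen_mult_nonzero[OF I_b_nonzero] by simp
    qed
    with witt_f_I_b_independent[OF S] show ?thesis by blast
  qed
  then show "super_holomorphic m n \<Omega> F" by (simp add: super_holomorphic_def)
qed

end
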